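(* Let $A=\mathbb{F}_2[x,y]/(y^2+y+x^3+x+1)$ and $K=\mathrm{Frac}(A)$. For every integer $k\ge 2$, the quotient $R_k(w)=p_k(w)/e_k(w)$ satisfies $$R_k(w)=\frac{1}{d_k}\,e_k(w)+C,\qquad\text{where } C=\frac{1}{d_{k-1}}+\frac{B_{k,k-2}^2}{d_k}.$$
   Context: Let $A=\mathbb{F}_2[x,y]/(y^2+y+x^3+x+1)$, with fraction field $K$. The degree function on $A$ is the one given by the place at infinity: $\deg(x)=2$, $\deg(y)=3$. That is, $A$ has $\mathbb{F}_2$-basis $\{x^i, yx^i : i\ge 0\}$ with $\deg(x^i)=2i$ and $\deg(yx^i)=2i+3$; the degree of a nonzero element is the maximum of the degrees of the basis elements occurring in it, and $\deg 0=-\infty$. Let $\tau$ be the Frobenius $z\mapsto z^2$, so a twisted polynomial $\sum_i c_i\tau^i$ acts by $z\mapsto\sum_i c_i z^{2^i}$ and $\tau c=c^2\tau$. The Drinfeld $A$-module $\rho$ is the $\mathbb{F}_2$-algebra homomorphism from $A$ to twisted polynomials determined by $$\rho_x=x+(x^2+x)\tau+\tau^2,\qquad \rho_y=y+(y^2+y)\tau+x(y^2+y)\tau^2+\tau^3.$$ Its normalized exponential is the unique power series $e(z)=\sum_{i\ge0}z^{2^i}/d_i=\sum_{i\ge 0}a_iz^{2^i}$ over $K$ with $d_0=1$ satisfying $e(xz)=\rho_x(e(z))=x\,e(z)+(x^2+x)e(z)^2+e(z)^4$. The normalized logarithm $\log(z)=\sum_{i\ge0}z^{2^i}/\ell_i=\sum_{i\ge0}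 b_iz^{2^i}$ (with $\ell_0=1$) is the formal compositional inverse of $e(z)$. Here $a_i=d_i^{-1}$ and $b_i=\ell_i^{-1}$. Equivalently, with $[j]_x=x^{2^j}+x$: $a_0=a_1=1$ and $a_j=([1]_xa_{j-1}^2+a_{j-2}^4)/[j]_x$ for $j\ge2$; $b_0=b_1=1$ and $b_j=([1]_x^{2^{j-1}}b_{j-1}+b_{j-2})/[j]_x$ for $j\ge 2$. Define $$p_k(w)=\sum_{j=0}^k\frac{w^{2^j}}{d_j\,\ell_{k-j}^{2^j}}\in K[w].$$ Define $A_{<k}=\{a\in A:\deg(a)<k\}$ (including $0$) and $e_k(w)=\prod_{a\in A_{<k}}(w+a)$. For $k\ge2$, $A_{<k}$ is an $\mathbb{F}_2$-vector space of dimension $k-1$, and $B_{k,i}\in A$ are the coefficients in $e_k(w)=\sum_{i=0}^{k-1}B_{k,i}w^{2^i}$. *)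

theory Defs
  imports
    "HOL-Library.Z2"
    "HOL-Library.Extended_Real"
    "HOL-Computational_Algebra.Computational_Algebra"
begin

section \<open>The coordinate ring \<open>A = \<bbbF>\<^sub>2[x,y]/(y\<^sup>2+y+x\<^sup>3+x+1)\<close>\<close>

text \<open>\<open>\<bbbF>\<^sub>2[x,y]\<close> is \<open>\<bbbF>\<^sub>2[x][y]\<close>: the inner polynomial variable is \<open>x\<close>, the outer one is \<open>y\<close>.\<close>

abbreviation polyX :: "bit poly poly" where "polyX \<equiv> [:[:0, 1:]:]"
abbreviation polyY :: "bit poly poly" where "polyY \<equiv> [:0, 1:]"

definition curve :: "bit poly poly" where
  "curve = polyY ^ 2 + polyY + polyX ^ 3 + polyX + 1"

lemma curve_eq: "curve = [:[:1, 1, 0, 1:], 1, 1:]"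
  by (simp add: curve_def power2_eq_square power3_eq_cube one_pCons)

quotient_type coord_ring = "bit poly poly" / "\<lambda>p q. curve dvd (p - q)"
proof (rule equivpI)
  show "reflp (\<lambda>p q. curve dvd (p - q))"
    by (rule reflpI) simp
  show "symp (\<lambda>p q. curve dvd (p - q))"
  proof (rule sympI)
    fix p q :: "bit poly poly" assume "curve dvd p - q"
    then have "curve dvd - (p - q)" by (simp only: dvd_minus_iff)
    then show "curve dvd q - p" by (simp only: minus_diff_eq)
  qed
  show "transp (\<lambda>p q. curve dvd (p - q))"
  proof (rule transpI)
    fix p q r :: "bit poly poly" assume "curve dvd p - q" "curve dvd q - r"
    then have "curve dvd (p - q) + (q - r)" by (rule dvd_add)
    then show "curve dvd p - r" by simp
  qed
qed

instantiation coord_ring :: comm_ring_1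
begin

lift_definition zero_coord_ring :: coord_ring is 0 .
lift_definition one_coord_ring :: coord_ring is 1 .

lift_definition plus_coord_ring :: "coord_ring \<Rightarrow> coord_ring \<Rightarrow> coord_ring" is "(+)"
proof -
  fix p p' q q' :: "bit poly poly"
  assume "curve dvd p - p'" "curve dvd q - q'"
  then have "curve dvd (p - p') + (q - q')" by (rule dvd_add)
  then show "curve dvd (p + q) - (p' + q')" by (simp only: add_diff_add)
qed

lift_definition minus_coord_ring :: "coord_ring \<Rightarrow> coord_ring \<Rightarrow> coord_ring" is "(-)"
proof -
  fix p p' q q' :: "bit poly poly"
  assume "curve dvd p - p'" "curve dvd q - q'"
  moreover have "(p - q) - (p' - q') = (p - p') - (q - q')" by simp
  ultimately show "curve dvd (p - q) - (p' - q')" by (metis dvd_diff)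
qed

lift_definition uminus_coord_ring :: "coord_ring \<Rightarrow> coord_ring" is uminus
proof -
  fix p p' :: "bit poly poly"
  assume "curve dvd p - p'"
  then have "curve dvd - (p - p')" by (simp only: dvd_minus_iff)
  then show "curve dvd - p - - p'" by (simp only: minus_diff_minus)
qed

lift_definition times_coord_ring :: "coord_ring \<Rightarrow> coord_ring \<Rightarrow> coord_ring" is "(*)"
proof -
  fix p p' q q' :: "bit poly poly"
  assume "curve dvd p - p'" "curve dvd q - q'"
  moreover have "p * q - p' * q' = p * (q - q') + (p - p') * q'" by (simp add: algebra_simps)
  ultimately show "curve dvd p * q - p' * q'" by simp
qed

lemma dvd_diff_eqI: "p = q \<Longrightarrow> curve dvd p - q"
  by simp

lemma degree_curve: "degree curve = 2"
  by (simp add: curve_eq)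

instance
proof
  show "(0::coord_ring) \<noteq> 1"
  proof transfer
    show "\<not> curve dvd 0 - (1 :: bit poly poly)"
      using dvd_imp_degree_le[of curve 1] by (auto simp: degree_curve)
  qed
qed (transfer, rule dvd_diff_eqI, simp add: algebra_simps; fail)+

end

definition A_of :: "bit poly poly \<Rightarrow> coord_ring" where "A_of = abs_coord_ring"

definition xA :: coord_ring where "xA = A_of polyX"
definition yA :: coord_ring where "yA = A_of polyY"

lemma A_of_eq_iff: "A_of p = A_of q \<longleftrightarrow> curve dvd p - q"
  by (simp add: A_of_def coord_ring.abs_eq_iff)

lemma A_of_hom [simp]:
  "A_of 0 = 0" "A_of 1 = 1" "A_of (p + q) = A_of p + A_of q" "A_of (p - q) = A_of p - A_of q"
  "A_of (p * q) = A_of p * A_of q"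
  by (simp_all add: A_of_def zero_coord_ring_def one_coord_ring_def plus_coord_ring.abs_eq
      minus_coord_ring.abs_eq times_coord_ring.abs_eq)

lemma curve_relation: "yA ^ 2 + yA + xA ^ 3 + xA + 1 = 0"
proof -
  have "A_of curve = 0" using A_of_eq_iff[of curve 0] by simp
  then show ?thesis
    unfolding curve_def xA_def yA_def power2_eq_square power3_eq_cube A_of_hom .
qed

lemma ex_linear_rep: "\<exists>u v. curve dvd p - [:u, v:]"
proof (induction p)
  case 0
  have "curve dvd 0 - [:0, 0:]" by simp
  then show ?case by blast
next
  case (pCons c p)
  then obtain u v where "curve dvd p - [:u, v:]" by blast
  then have "curve dvd polyY * (p - [:u, v:]) + smult v curve"
    by (rule dvd_add[OF dvd_mult dvd_smult[OF dvd_refl]])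
  moreover have "polyY * (p - [:u, v:]) + smult v curve
      = pCons c p - [:c - v * [:1, 1, 0, 1:], u - v:]"
    by (simp add: curve_eq algebra_simps)
  ultimately show ?case by metis
qed

lemma linear_rep_unique:
  assumes "curve dvd [:u, v:] - [:u', v':]"
  shows "u = u'" "v = v'"
proof -
  have "[:u, v:] - [:u', v':] = 0"
  proof (rule ccontr)
    assume "[:u, v:] - [:u', v':] \<noteq> 0"
    then have "degree curve \<le> degree ([:u, v:] - [:u', v':])"
      using assms dvd_imp_degree_le by blast
    moreover have "degree ([:u, v:] - [:u', v':]) \<le> 1" by simp
    ultimately show False by (simp add: degree_curve)
  qed
  then show "u = u'" "v = v'" by auto
qed

lemma norm_form_eq_0:
  fixes u v :: "bit poly"
  assumes "u * u + u * v = v * v * [:1, 1, 0, 1:]"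
  shows "u = 0 \<and> v = 0"
proof (cases "v = 0")
  case True
  then show ?thesis using assms by simp
next
  case v: False
  have dr: "degree (v * v * [:1, 1, 0, 1:]) = 2 * degree v + 3"
    using v by (subst degree_mult_eq) (auto simp: degree_mult_eq)
  show ?thesis
  proof (cases "degree u \<le> degree v + 1")
    case True
    have "degree (u * (u + v)) \<le> degree u + degree (u + v)" by (rule degree_mult_le)
    moreover have "degree (u + v) \<le> degree v + 1"
      using True by (intro degree_add_le) auto
    ultimately have "degree (u * u + u * v) \<le> 2 * degree v + 2"
      using True by (simp add: algebra_simps)
    then show ?thesis using assms dr by simp
  next
    case False
    then have "u \<noteq> 0" by auto
    have d: "degree (u + v) = degree u" using False by (intro degree_add_eq_left) auto
    then have "u + v \<noteq> 0" using False by auto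
    then have "degree (u * (u + v)) = 2 * degree u"
      using \<open>u \<noteq> 0\<close> d by (simp add: degree_mult_eq)
    moreover have "u * (u + v) = v * v * [:1, 1, 0, 1:]"
      using assms by (simp add: algebra_simps)
    ultimately have "2 * degree u = 2 * degree v + 3" using dr by metis
    then show ?thesis by presburger
  qed
qed

lemma mult_diff_mult_diff:
  fixes a b x y :: "'a :: comm_ring_1"
  shows "x * y = a * b - ((a - x) * b + x * (b - y))"
  by (simp add: algebra_simps)

lemma norm_form_mult_eq_0:
  fixes u v s t g :: "'a :: comm_ring_1"
  assumes us: "u * s = v * t * g" and vs: "u * t + v * s = v * t"
  shows "t * (u * u - u * v + v * v * g) = 0"
proof -
  have "t * (u * u - u * v + v * v * g) = u * (u * t) + v * (v * t * g) - u * (v * t)"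
    by (simp add: algebra_simps)
  also have "\<dots> = u * (u * t) + v * (u * s) - u * (u * t + v * s)"
    by (simp only: us vs)
  also have "\<dots> = 0"
    by (simp add: algebra_simps)
  finally show ?thesis .
qed

instance coord_ring :: idom
proof
  fix a b :: coord_ring
  assume ne: "a \<noteq> 0" "b \<noteq> 0"
  show "a * b \<noteq> 0"
    using ne
  proof transfer
    fix p q :: "bit poly poly"
    assume np: "\<not> curve dvd p - 0" and nq: "\<not> curve dvd q - 0"
    show "\<not> curve dvd p * q - 0"
    proof
      assume dv: "curve dvd p * q - 0"
      obtain u v where uv: "curve dvd p - [:u, v:]" using ex_linear_rep by blast
      obtain s t where st: "curve dvd q - [:s, t:]" using ex_linear_rep by blast
      have eq: "[:u, v:] * [:s, t:] = p * q - ((p - [:u, v:]) * q + [:u, v:] * (q - [:s, t:]))"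
        by (rule mult_diff_mult_diff)
      have "curve dvd [:u, v:] * [:s, t:]"
        unfolding eq
      proof (rule dvd_diff)
        show "curve dvd p * q" using dv by simp
        show "curve dvd (p - [:u, v:]) * q + [:u, v:] * (q - [:s, t:])"
          by (rule dvd_add[OF dvd_mult2[OF uv] dvd_mult[OF st]])
      qed
      then have "curve dvd [:u, v:] * [:s, t:] - smult (v * t) curve"
        by (rule dvd_diff[OF _ dvd_smult[OF dvd_refl]])
      moreover have "[:u, v:] * [:s, t:] - smult (v * t) curve
          = [:u * s - v * t * [:1, 1, 0, 1:], u * t + v * s - v * t:] - [:0, 0:]"
        by (simp add: curve_eq algebra_simps)
      ultimately have "curve dvd [:u * s - v * t * [:1, 1, 0, 1:], u * t + v * s - v * t:] - [:0, 0:]"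
        by metis
      note z = linear_rep_unique[OF this]
      have us: "u * s = v * t * [:1, 1, 0, 1:]" and vs: "u * t + v * s = v * t"
        using z by (simp_all only: right_minus_eq)
      have "t * (u * u - u * v + v * v * [:1, 1, 0, 1:]) = 0"
        by (rule norm_form_mult_eq_0[OF us vs])
      moreover have nz: "u \<noteq> 0 \<or> v \<noteq> 0" using np uv by auto
      moreover have "u * u - u * v + v * v * [:1, 1, 0, 1:] \<noteq> 0"
      proof
        assume "u * u - u * v + v * v * [:1, 1, 0, 1:] = 0"
        then have e: "u * u - u * v = - (v * v * [:1, 1, 0, 1:])"
          by (simp only: eq_neg_iff_add_eq_0)
        have m: "- r = r" for r :: "bit poly"
          by (intro poly_eqI) simp
        have "u * u + u * v = v * v * [:1, 1, 0, 1:]"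
          using e by (simp only: diff_conv_add_uminus m)
        then show False using norm_form_eq_0 nz by blast
      qed
      ultimately have t0: "t = 0" by (metis mult_eq_0_iff)
      with us vs have "u * s = 0" "v * s = 0" by auto
      with nz have "s = 0" by auto
      with t0 st nq show False by simp
    qed
  qed
qed

type_synonym K = "coord_ring fract"

section \<open>The degree\<close>

text \<open>
  The coordinates of an element of \<open>A\<close> with respect to the basis \<open>{x\<^sup>i, y x\<^sup>i}\<close>,
  collected as the two polynomials \<open>u, v\<close> in \<open>a = u(x) + y v(x)\<close>.
\<close>

lemma ex1_coords: "\<exists>!(u, v). a = A_of [:u:] + yA * A_of [:v:]"
proof -
  have rep: "A_of [:u:] + yA * A_of [:v:] = A_of [:u, v:]" for u v
    unfolding yA_def A_of_hom[symmetric] by simp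
  have "\<exists>p. a = A_of p"
    unfolding A_of_def by (induct a rule: coord_ring.abs_induct) blast
  then obtain p where p: "a = A_of p" by blast
  obtain u v where uv: "curve dvd p - [:u, v:]" using ex_linear_rep by blast
  show ?thesis
  proof (rule ex1I[of _ "(u, v)"])
    show "case (u, v) of (u, v) \<Rightarrow> a = A_of [:u:] + yA * A_of [:v:]"
      using uv by (simp add: rep p A_of_eq_iff)
  next
    fix w assume "case w of (u, v) \<Rightarrow> a = A_of [:u:] + yA * A_of [:v:]"
    then obtain u' v' where w: "w = (u', v')" "a = A_of [:u', v':]"
      by (cases w) (auto simp: rep)
    have "A_of p = A_of [:u, v:]" using uv by (simp only: A_of_eq_iff)
    then have "A_of [:u', v':] = A_of [:u, v:]" using w(2) p by (simp only:)
    then show "w = (u, v)" using w linear_rep_unique by (simp only: A_of_eq_iff) blast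
  qed
qed

definition coords :: "coord_ring \<Rightarrow> bit poly \<times> bit poly" where
  "coords a = (THE (u, v). a = A_of [:u:] + yA * A_of [:v:])"

lemma coords_eqI: "a = A_of [:u:] + yA * A_of [:v:] \<Longrightarrow> coords a = (u, v)"
  unfolding coords_def using the1_equality[OF ex1_coords, of a "(u, v)"] by simp

lemma coords_eqD: "coords a = (u, v) \<Longrightarrow> a = A_of [:u:] + yA * A_of [:v:]"
  using theI'[OF ex1_coords, of a] unfolding coords_def by auto

definition basis_degrees :: "coord_ring \<Rightarrow> nat set" where
  "basis_degrees a =
     {2 * i |i. coeff (fst (coords a)) i \<noteq> 0} \<union> {2 * i + 3 |i. coeff (snd (coords a)) i \<noteq> 0}"

definition degA :: "coord_ring \<Rightarrow> ereal" where
  "degA a = (if a = 0 then -\<infinity> else ereal (real (Max (basis_degrees a))))"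

definition A_lt :: "nat \<Rightarrow> coord_ring set" where
  "A_lt k = {a. degA a < ereal (real k)}"

lemma finite_basis_degrees: "finite (basis_degrees a)"
proof -
  have "basis_degrees a \<subseteq> (\<lambda>i. 2 * i) ` {..degree (fst (coords a))}
      \<union> (\<lambda>i. 2 * i + 3) ` {..degree (snd (coords a))}"
    unfolding basis_degrees_def using le_degree by fastforce
  then show ?thesis by (rule finite_subset) auto
qed

lemma basis_degrees_nonempty: "a \<noteq> 0 \<Longrightarrow> basis_degrees a \<noteq> {}"
proof
  assume "a \<noteq> 0" "basis_degrees a = {}"
  then have "coords a = (0, 0)"
    unfolding basis_degrees_def by (auto simp: prod_eq_iff poly_eq_iff simp del: bit_not_zero_iff)
  from coords_eqD[OF this] \<open>a \<noteq> 0\<close> show False by simp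
qed

lemma degA_x: "degA xA = 2" and degA_y: "degA yA = 3"
proof -
  have cx: "coords xA = (monom 1 1, 0)"
    by (rule coords_eqI) (simp add: xA_def monom_altdef)
  have cy: "coords yA = (0, 1)" by (rule coords_eqI) (simp flip: one_pCons)
  have c1: "coeff 1 i = (1 :: bit) \<longleftrightarrow> i = 0" for i by (cases i) auto
  have x: "basis_degrees xA = {2}" and y: "basis_degrees yA = {3}"
    unfolding basis_degrees_def cx cy by (auto simp: c1)
  have "xA \<noteq> 0" "yA \<noteq> 0" using cx cy coords_eqI[of 0 0 0] by auto
  then show "degA xA = 2" "degA yA = 3" by (simp_all add: degA_def x y)
qed

lemma finite_A_lt: "finite (A_lt k)"
proof -
  define P where "P = {p :: bit poly. degree p \<le> k}"
  have "P \<subseteq> Poly ` {xs. set xs \<subseteq> (UNIV :: bit set) \<and> length xs \<le> k + 1}"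
  proof
    fix p assume "p \<in> P"
    then have "length (coeffs p) \<le> k + 1" by (cases "p = 0") (auto simp: P_def length_coeffs)
    then show "p \<in> Poly ` {xs. set xs \<subseteq> (UNIV :: bit set) \<and> length xs \<le> k + 1}"
      by (intro image_eqI[of _ _ "coeffs p"]) auto
  qed
  moreover have "finite (UNIV :: bit set)"
  proof -
    have "(UNIV :: bit set) \<subseteq> {0, 1}" by auto
    then show ?thesis by (rule finite_subset) simp
  qed
  ultimately have "finite P"
    using finite_lists_length_le[of "UNIV :: bit set" "k + 1"] finite_surj by blast
  have "coords a \<in> P \<times> P" if "a \<in> A_lt k" for a
  proof (cases "a = 0")
    case True
    then have "coords a = (0, 0)" by (intro coords_eqI) simp
    then show ?thesis by (simp add: P_def)
  next
    case False
    then have lt: "Max (basis_degrees a) < k" using that by (simp add: A_lt_def degA_def)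
    obtain u v where uv: "coords a = (u, v)" by fastforce
      have ltk: "n < k" if "n \<in> basis_degrees a" for n
      using lt Max_ge[OF finite_basis_degrees that] by simp
    have "coeff u i = 0" if "k < i" for i
    proof (rule ccontr)
      assume "coeff u i \<noteq> 0"
      then have "2 * i \<in> basis_degrees a" unfolding basis_degrees_def uv by auto
      then show False using ltk that by fastforce
    qed
    moreover have "coeff v i = 0" if "k < i" for i
    proof (rule ccontr)
      assume "coeff v i \<noteq> 0"
      then have "2 * i + 3 \<in> basis_degrees a" unfolding basis_degrees_def uv by auto
      then show False using ltk that by fastforce
    qed
    ultimately show ?thesis unfolding uv P_def by (simp add: degree_le)
  qed
  then have "coords ` A_lt k \<subseteq> P \<times> P" by blast
  moreover have "inj_on coords (A_lt k)"
    by (rule inj_onI) (metis coords_eqD prod.exhaust_sel)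
  ultimately show ?thesis
    using \<open>finite P\<close> finite_subset[of "coords ` A_lt k" "P \<times> P"] finite_imageD by blast
qed

section \<open>The Drinfeld module, its exponential and logarithm\<close>

text \<open>
  A twisted polynomial \<open>\<Sum>\<^sub>i c\<^sub>i \<tau>\<^sup>i\<close> is represented by the polynomial with coefficients \<open>c\<^sub>i\<close>;
  below is its action on power series.
\<close>

definition twisted_apply :: "K poly \<Rightarrow> K fps \<Rightarrow> K fps" where
  "twisted_apply c f = (\<Sum>i\<le>degree c. fps_const (coeff c i) * f ^ (2 ^ i))"

definition xK :: K where "xK = to_fract xA"

definition rho_x :: "K poly" where "rho_x = [:xK, xK ^ 2 + xK, 1:]"

lemma twisted_apply_rho_x:
  "twisted_apply rho_x f = fps_const xK * f + fps_const (xK ^ 2 + xK) * f ^ 2 + f ^ 4"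
proof -
  have "f * (f * (f * f)) = f ^ 4"
    by (simp add: power4_eq_xxxx mult.assoc)
  then show ?thesis
    by (simp add: twisted_apply_def rho_x_def numeral_2_eq_2)
qed

definition is_normalized_exp :: "K fps \<Rightarrow> bool" where
  "is_normalized_exp e \<longleftrightarrow>
     (\<forall>n. n \<notin> range ((^) 2) \<longrightarrow> fps_nth e n = 0) \<and>
     fps_nth e (2 ^ 0) = 1 \<and>
     fps_compose e (fps_const xK * fps_X) = twisted_apply rho_x e"

definition exp_rho :: "K fps" where "exp_rho = (THE e. is_normalized_exp e)"

lemma K_add_self: "(z :: K) + z = 0"
proof -
  have "b + b = 0" for b :: bit
    by (cases b) auto
  then have b: "p + p = 0" for p :: "bit poly poly"
    by (intro poly_eqI) (simp only: coeff_add coeff_0)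
  have "(a :: coord_ring) + a = 0" for a
    by transfer (simp add: b)
  then have "(1 :: coord_ring) + 1 = 0" .
  then have "to_fract (1 + 1 :: coord_ring) = 0" by simp
  then have "(1 :: K) + 1 = 0" by (simp only: to_fract_add to_fract_1)
  then have "(1 + 1) * z = 0" by (simp only: mult_zero_left)
  then show ?thesis by (simp only: distrib_right mult_1)
qed

lemma fps_square_char2:
  fixes f :: "K fps"
  shows "f ^ 2 = Abs_fps (\<lambda>n. if even n then fps_nth f (n div 2) ^ 2 else 0)"
proof -
  have "fps_nth (f ^ 2) n = (if even n then fps_nth f (n div 2) ^ 2 else 0)" for n
  proof (induction n arbitrary: f rule: less_induct)
    case (less n)
    define g where "g = fps_shift 1 f"
    have f: "f = fps_const (fps_nth f 0) + fps_X * g"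
      by (rule fps_ext) (simp add: g_def)
    have dbl: "h + h = 0" for h :: "K fps"
      by (rule fps_ext) (simp only: fps_add_nth fps_zero_nth K_add_self)
    have "f ^ 2 = (fps_const (fps_nth f 0) + fps_X * g) ^ 2" using f by simp
    also have "\<dots> = fps_const (fps_nth f 0) ^ 2 + fps_X ^ 2 * g ^ 2
        + (fps_const (fps_nth f 0) * (fps_X * g) + fps_const (fps_nth f 0) * (fps_X * g))"
      by (simp add: power2_eq_square algebra_simps)
    also have "\<dots> = fps_const (fps_nth f 0 ^ 2) + fps_X ^ 2 * g ^ 2"
      by (simp only: dbl fps_const_power) simp
    finally have sq: "fps_nth (f ^ 2) n =
        (if n = 0 then fps_nth f 0 ^ 2 else 0) + (if n < 2 then 0 else fps_nth (g ^ 2) (n - 2))"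
      by (simp add: fps_X_power_mult_nth)
    show ?case
    proof (cases "n < 2")
      case True
      then have "n = 0 \<or> n = 1" by auto
      then show ?thesis using sq by auto
    next
      case False
      then have "fps_nth (f ^ 2) n = fps_nth (g ^ 2) (n - 2)" using sq by simp
      also have "\<dots> = (if even (n - 2) then fps_nth g ((n - 2) div 2) ^ 2 else 0)"
        using less.IH[of "n - 2" g] False by simp
      moreover have "Suc ((n - 2) div 2) = n div 2" using False by presburger
      ultimately show ?thesis using False by (auto simp: g_def)
    qed
  qed
  then show ?thesis by (intro fps_ext) simp
qed

lemma xK_power_ne:
  assumes "n \<ge> 2"
  shows "xK ^ n + xK \<noteq> 0"
proof
  assume "xK ^ n + xK = 0"
  moreover have "to_fract (xA ^ m) = xK ^ m" for m
    by (induction m) (simp_all add: xK_def)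
  ultimately have "to_fract (xA ^ n + xA) = 0" by (simp add: xK_def)
  then have z: "xA ^ n + xA = 0" by (simp only: to_fract_eq_0_iff)
  have pw: "A_of (p ^ m) = A_of p ^ m" for p m by (induction m) simp_all
  have "A_of (polyX ^ n + polyX) = A_of 0" using z by (simp add: xA_def pw)
  moreover have "polyX ^ n + polyX = [:monom 1 n + [:0, 1:], 0:]"
    by (simp add: poly_const_pow monom_altdef)
  ultimately have "curve dvd [:monom 1 n + [:0, 1:], 0:] - [:0, 0:]"
    using A_of_eq_iff[of "[:monom 1 n + [:0, 1:]:]" 0] by simp
  then have "monom 1 n + [:0, 1:] = (0 :: bit poly)" by (rule linear_rep_unique)
  then have "coeff (monom 1 n + [:0, 1:] :: bit poly) n = 0" by simp
  then show False using assms by (auto simp: coeff_pCons split: nat.splits)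
qed

lemma exp_equation_iff:
  fixes e :: "K fps"
  shows "fps_compose e (fps_const xK * fps_X) = twisted_apply rho_x e \<longleftrightarrow>
    (\<forall>n. (xK ^ n + xK) * fps_nth e n =
       (if even n then (xK ^ 2 + xK) * fps_nth e (n div 2) ^ 2 else 0) +
       (if 4 dvd n then fps_nth e (n div 4) ^ 4 else 0))"
proof -
  have "e ^ 4 = (e ^ 2) ^ 2" by (simp flip: power_mult)
  then have e4: "fps_nth (e ^ 4) n = (if 4 dvd n then fps_nth e (n div 4) ^ 4 else 0)" for n
    by (auto simp: fps_square_char2 div_mult2_eq[symmetric] power_mult[symmetric] elim!: evenE)
  have e2: "fps_nth (e ^ 2) n = (if even n then fps_nth e (n div 2) ^ 2 else 0)" for n
    by (simp add: fps_square_char2)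
  have "xK ^ n * a = xK * a + b + c \<longleftrightarrow> (xK ^ n + xK) * a = b + c" for n a b c
  proof -
    have neg: "- z = z" for z :: K
      using K_add_self[of z] by (simp only: neg_eq_iff_add_eq_0)
    have "(xK ^ n + xK) * a = xK ^ n * a - xK * a"
      by (simp only: distrib_right diff_conv_add_uminus neg)
    then show ?thesis by (simp only: diff_eq_eq add_ac)
  qed
  then show ?thesis
    by (simp add: fps_eq_iff fps_compose_linear twisted_apply_rho_x e2 e4)
qed

fun exp_coeff_rec :: "nat \<Rightarrow> K" where
  "exp_coeff_rec 0 = 1"
| "exp_coeff_rec (Suc 0) = 1"
| "exp_coeff_rec (Suc (Suc j)) =
     ((xK ^ 2 + xK) * exp_coeff_rec (Suc j) ^ 2 + exp_coeff_rec j ^ 4) / (xK ^ (2 ^ Suc (Suc j)) + xK)"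

lemma ex1_normalized_exp: "\<exists>!e. is_normalized_exp e"
proof (rule ex_ex1I)
  define e :: "K fps" where
    "e = Abs_fps (\<lambda>n. if n \<in> range ((^) 2) then exp_coeff_rec (THE j. n = 2 ^ j) else 0)"
  have e2: "fps_nth e (2 ^ j) = exp_coeff_rec j" for j
  proof -
    have "(THE i. (2 :: nat) ^ j = 2 ^ i) = j" by (rule the_equality) auto
    then show ?thesis by (simp add: e_def)
  qed
  have e0: "fps_nth e n = 0" if "n \<notin> range ((^) 2)" for n
    using that by (simp add: e_def)
  have "(xK ^ n + xK) * fps_nth e n =
       (if even n then (xK ^ 2 + xK) * fps_nth e (n div 2) ^ 2 else 0) +
       (if 4 dvd n then fps_nth e (n div 4) ^ 4 else 0)" for n
  proof (cases "n \<in> range ((^) 2)")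
    case True
    then obtain i where n: "n = 2 ^ i" by auto
    consider "i = 0" | "i = Suc 0" | j where "i = Suc (Suc j)"
      by (metis old.nat.exhaust)
    then show ?thesis
    proof cases
      case 1
      then show ?thesis using K_add_self by (simp add: n)
    next
      case 2
      have "fps_nth e 1 = 1" "fps_nth e 2 = 1" using e2[of 0] e2[of 1] by auto
      then show ?thesis using 2 by (simp add: n)
    next
      case (3 j)
      have 4: "n = 4 * 2 ^ j" using 3 n by simp
      then have dv: "even n" "4 dvd n" "n div 2 = 2 ^ Suc j" "n div 4 = 2 ^ j" by auto
      have ne: "xK ^ n + xK \<noteq> 0"
        using 4 by (intro xK_power_ne) (simp add: Suc_le_eq trans_le_add1)
      have "fps_nth e n =
          ((xK ^ 2 + xK) * fps_nth e (2 ^ Suc j) ^ 2 + fps_nth e (2 ^ j) ^ 4) / (xK ^ n + xK)"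
        unfolding n 3 e2 by (rule exp_coeff_rec.simps(3))
      then show ?thesis using dv ne by simp
    qed
  next
    case False
    have "n div 2 \<notin> range ((^) 2)" if ev: "even n"
    proof
      assume "n div 2 \<in> range ((^) 2)"
      then obtain i where "n div 2 = 2 ^ i" by auto
      then have "n = 2 ^ Suc i" using ev by auto
      then show False using False by blast
    qed
    moreover have "n div 4 \<notin> range ((^) 2)" if ev: "4 dvd n"
    proof
      assume "n div 4 \<in> range ((^) 2)"
      then obtain i where "n div 4 = 2 ^ i" by auto
      then have "n = 2 ^ Suc (Suc i)" using ev by auto
      then show False using False by blast
    qed
    ultimately show ?thesis using False by (simp add: e0)
  qed
  then have "is_normalized_exp e"
    unfolding is_normalized_exp_def exp_equation_iff using e0 e2[of 0] by (intro conjI allI impI) simp_all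
  then show "\<exists>e. is_normalized_exp e" by blast
next
  fix e f :: "K fps"
  assume E: "is_normalized_exp e" and F: "is_normalized_exp f"
  have "fps_nth e n = fps_nth f n" for n
  proof (induction n rule: less_induct)
    case (less n)
    consider "n = 0" | "n = 1" | "n \<ge> 2" by linarith
    then show ?case
    proof cases
      case 1
      then have "n \<notin> range ((^) 2)" by auto
      then show ?thesis using E F unfolding is_normalized_exp_def by metis
    next
      case 2
      then show ?thesis using E F unfolding is_normalized_exp_def by simp
    next
      case 3
      have "(xK ^ n + xK) * fps_nth e n = (xK ^ n + xK) * fps_nth f n"
        using E F less.IH[of "n div 2"] less.IH[of "n div 4"] 3
        unfolding is_normalized_exp_def exp_equation_iff by auto
      then show ?thesis using xK_power_ne[OF 3] by simp
    qed
  qed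
  then show "e = f" by (rule fps_ext)
qed

lemma exp_rho: "is_normalized_exp exp_rho"
  unfolding exp_rho_def by (rule theI'[OF ex1_normalized_exp])

definition log_rho :: "K fps" where "log_rho = fps_inv exp_rho"

lemma exp_rho_log_rho:
  "fps_compose log_rho exp_rho = fps_X" "fps_compose exp_rho log_rho = fps_X"
proof -
  have "0 \<notin> range ((^) (2 :: nat))" by auto
  then have "fps_nth exp_rho 0 = 0" "fps_nth exp_rho 1 \<noteq> 0"
    using exp_rho unfolding is_normalized_exp_def by auto
  then show "fps_compose log_rho exp_rho = fps_X" "fps_compose exp_rho log_rho = fps_X"
    unfolding log_rho_def by (rule fps_inv, rule fps_inv_right)
qed

text \<open>\<open>d\<^sub>i\<close> and \<open>\<ell>\<^sub>i\<close> are the inverses of the coefficients of \<open>z\<^bsup>2^i\<^esup>\<close> in \<open>e\<close> and \<open>log\<close>.\<close>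

definition d_seq :: "nat \<Rightarrow> K" where "d_seq i = inverse (fps_nth exp_rho (2 ^ i))"
definition l_seq :: "nat \<Rightarrow> K" where "l_seq i = inverse (fps_nth log_rho (2 ^ i))"

section \<open>The polynomials \<open>p\<^sub>k\<close>, \<open>e\<^sub>k\<close> and the quotient \<open>R\<^sub>k\<close>\<close>

definition p_poly :: "nat \<Rightarrow> K poly" where
  "p_poly k = (\<Sum>j\<le>k. monom (1 / (d_seq j * l_seq (k - j) ^ (2 ^ j))) (2 ^ j))"

definition e_poly :: "nat \<Rightarrow> coord_ring poly" where
  "e_poly k = (\<Prod>a\<in>A_lt k. [:a, 1:])"

definition B_coeff :: "nat \<Rightarrow> nat \<Rightarrow> coord_ring" where
  "B_coeff k i = coeff (e_poly k) (2 ^ i)"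

definition e_poly_K :: "nat \<Rightarrow> K poly" where
  "e_poly_K k = map_poly to_fract (e_poly k)"

definition R_quot :: "nat \<Rightarrow> K poly fract" where
  "R_quot k = to_fract (p_poly k) / to_fract (e_poly_K k)"

lemma e_poly_K_nonzero: "e_poly_K k \<noteq> 0"
proof -
  have "e_poly k \<noteq> 0"
    unfolding e_poly_def using finite_A_lt by simp
  then show ?thesis
    unfolding e_poly_K_def by (simp add: map_poly_eq_0_iff)
qed

end

theory Submission
  imports Defs
begin

text \<open>
  The polynomials \<open>p\<^sub>k\<close> are the coefficients of a generating series: formally,
  \<open>e(w log z) = \<Sum>\<^sub>k p\<^sub>k(w) z\<^bsup>2^k\<^esup>\<close>. For \<open>a \<in> A\<close> the functional equation of the
  exponential turns this series into \<open>\<rho>\<^sub>a(e(log z)) = \<rho>\<^sub>a(z)\<close>, a polynomial of degree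
  \<open>2\<^bsup>deg a\<^esup>\<close>. Hence \<open>p\<^sub>k\<close> vanishes at all \<open>a\<close> with \<open>deg a < k\<close>, which are exactly the
  \<open>2\<^bsup>k-1\<^esup>\<close> roots of \<open>e\<^sub>k\<close> (lemma \<open>p_poly_vanishes\<close>).

  Both \<open>p\<^sub>k\<close> and \<open>e\<^sub>k\<close> are linearized, that is, they only contain the monomials
  \<open>w\<^bsup>2^j\<^esup>\<close>, with \<open>j \<le> k\<close> and \<open>j \<le> k - 1\<close> respectively, and \<open>e\<^sub>k\<close> is monic. So constants
  \<open>\<alpha>\<close> and \<open>C\<close> can be chosen such that \<open>p\<^sub>k - \<alpha> e\<^sub>k\<^sup>2 - C e\<^sub>k\<close> has no monomials
  \<open>w\<^bsup>2^k\<^esup>\<close> and \<open>w\<^bsup>2^(k-1)\<^esup>\<close>. What remains has degree at most \<open>2\<^bsup>k-2\<^esup>\<close> and \<open>2\<^bsup>k-1\<^esup>\<close> roots,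
  so it is zero. Comparing the two coefficients gives \<open>\<alpha> = 1/d\<^sub>k\<close> and
  \<open>C = 1/d\<^sub>k\<^sub>-\<^sub>1 + B\<^sub>k\<^sub>,\<^sub>k\<^sub>-\<^sub>2\<^sup>2/d\<^sub>k\<close> (lemma \<open>p_poly_factorization\<close>), because
  \<open>\<ell>\<^sub>0 = \<ell>\<^sub>1 = 1\<close>.

  The exponential is characterized by its functional equation for \<open>x\<close> alone. The one for
  \<open>y\<close> (lemma \<open>exp_rho_y\<close>) follows because \<open>\<rho>\<^sub>x\<close> and \<open>\<rho>\<^sub>y\<close> commute, which is where the
  equation of the curve enters.
\<close>

section \<open>Characteristic two\<close>

lemma CHAR_K: "CHAR(K) = 2"
proof -
  have "of_nat 2 = (0 :: K)"
    using K_add_self[of 1] by simp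
  then have "CHAR(K) dvd 2"
    by (simp only: of_nat_eq_0_iff_char_dvd)
  then show ?thesis
    by (metis CHAR_not_1' Suc_0_not_prime_nat One_nat_def prime_nat_iff two_is_prime_nat)
qed

lemma char2_power_add:
  fixes a b :: "'a :: comm_ring_1"
  assumes "CHAR('a) = 2"
  shows "(a + b) ^ 2 ^ j = a ^ 2 ^ j + b ^ 2 ^ j"
  by (rule freshmans_dream') (simp_all add: assms)

lemma coord_ring_add_self: "(a :: coord_ring) + a = 0"
proof -
  have "to_fract (a + a) = 0" by (simp only: to_fract_add K_add_self)
  then show ?thesis by (simp only: to_fract_eq_0_iff)
qed

lemma fps_power2_nth:
  "fps_nth (f ^ 2) n = (if even n then fps_nth f (n div 2) ^ 2 else 0)" for f :: "K fps"
  by (simp add: fps_square_char2)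

lemma fps_power_pow2_nth:
  fixes f :: "K fps"
  shows "fps_nth (f ^ 2 ^ j) n = (if 2 ^ j dvd n then fps_nth f (n div 2 ^ j) ^ 2 ^ j else 0)"
proof (induction j arbitrary: n)
  case (Suc j)
  have pow: "a ^ 2 ^ Suc j = (a ^ 2 ^ j) ^ 2" for a :: "'b :: monoid_mult"
    by (simp only: power_Suc2 power_mult)
  show ?case
  proof (cases "even n")
    case True
    then have "2 ^ Suc j dvd n \<longleftrightarrow> 2 ^ j dvd n div 2" and "n div 2 ^ Suc j = n div 2 div 2 ^ j"
      by (auto elim!: evenE simp: div_mult2_eq)
    then show ?thesis
      unfolding pow fps_power2_nth using True Suc[of "n div 2"] by simp
  next
    case False
    then have "\<not> 2 ^ Suc j dvd n" using dvd_mult_left by auto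
    then show ?thesis
      unfolding pow fps_power2_nth using False by simp
  qed
qed simp

section \<open>The exponential and the logarithm\<close>

definition yK :: K where "yK = to_fract yA"

lemma curve_relation_K: "yK ^ 2 + yK = xK ^ 3 + xK + 1"
proof -
  have "to_fract (yA ^ 2 + yA + xA ^ 3 + xA + 1) = 0"
    by (simp only: curve_relation to_fract_0)
  then have "(yK ^ 2 + yK) + (xK ^ 3 + xK + 1) = 0"
    by (simp add: yK_def xK_def power2_eq_square power3_eq_cube add_ac)
  moreover have "(xK ^ 3 + xK + 1) + (xK ^ 3 + xK + 1) = 0"
    by (rule K_add_self)
  ultimately show ?thesis
    by (metis add_right_cancel)
qed

lemma exp_rho_nth_0: "fps_nth exp_rho 0 = 0"
  and exp_rho_nth_1: "fps_nth exp_rho 1 = 1"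
  and exp_rho_nth_eq_0: "n \<notin> range ((^) 2) \<Longrightarrow> fps_nth exp_rho n = 0"
  and exp_rho_x: "fps_compose exp_rho (fps_const xK * fps_X) = twisted_apply rho_x exp_rho"
proof -
  have "0 \<notin> range ((^) (2 :: nat))" by auto
  then show "fps_nth exp_rho 0 = 0" "fps_nth exp_rho 1 = 1"
    "n \<notin> range ((^) 2) \<Longrightarrow> fps_nth exp_rho n = 0"
    "fps_compose exp_rho (fps_const xK * fps_X) = twisted_apply rho_x exp_rho"
    using exp_rho unfolding is_normalized_exp_def by auto
qed

lemma log_rho_nth_0: "fps_nth log_rho 0 = 0"
  and log_rho_nth_1: "fps_nth log_rho 1 = 1"
  by (simp_all add: log_rho_def fps_inv_def exp_rho_nth_1[simplified])

text \<open>
  Comparing coefficients of \<open>z\<^bsup>n\<^esup>\<close> in \<open>f(xz) = \<rho>\<^sub>x(f(z))\<close> expresses \<open>(x\<^bsup>n\<^esup> + x) f\<^sub>n\<close> through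
  coefficients of smaller index, and \<open>x\<^bsup>n\<^esup> + x\<close> is nonzero
  for \<open>n \<ge> 2\<close>; so \<open>f\<^sub>0\<close> and \<open>f\<^sub>1\<close> determine \<open>f\<close>.
\<close>

lemma rho_x_eigen_unique:
  fixes f g :: "K fps"
  assumes f: "fps_compose f (fps_const xK * fps_X) = twisted_apply rho_x f"
    and g: "fps_compose g (fps_const xK * fps_X) = twisted_apply rho_x g"
    and 0: "fps_nth f 0 = fps_nth g 0" and 1: "fps_nth f 1 = fps_nth g 1"
  shows "f = g"
proof (rule fps_ext)
  fix n show "fps_nth f n = fps_nth g n"
  proof (induction n rule: less_induct)
    case (less n)
    show ?case
    proof (cases "n \<ge> 2")
      case True
      then have "(xK ^ n + xK) * fps_nth f n = (xK ^ n + xK) * fps_nth g n"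
        using f g less.IH[of "n div 2"] less.IH[of "n div 4"]
        unfolding exp_equation_iff by auto
      then show ?thesis using xK_power_ne[OF True] by simp
    next
      case False
      then have "n = 0 \<or> n = 1" by auto
      then show ?thesis using 0 1 by auto
    qed
  qed
qed

text \<open>
  The identity \<open>\<rho>\<^sub>y \<rho>\<^sub>x = \<rho>\<^sub>x \<rho>\<^sub>y\<close>, evaluated at an element \<open>e\<close> of an arbitrary commutative
  ring of characteristic two. Since squaring is additive, both sides expand to combinations of
  \<open>e, e\<^sup>2, e\<^sup>4, \<dots>, e\<^sup>3\<^sup>2\<close>, and it suffices to compare coefficients. Those of \<open>e\<close>, \<open>e\<^sup>2\<close>
  and \<open>e\<^sup>3\<^sup>2\<close> agree for any \<open>x\<close> and \<open>y\<close>; those of \<open>e\<^sup>4\<close>, \<open>e\<^sup>8\<close> and \<open>e\<^sup>1\<^sup>6\<close> agree once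
  \<open>y\<^sup>2 + y\<close> is replaced by \<open>x\<^sup>3 + x + 1\<close>.
\<close>

lemma rho_x_rho_y_commute:
  fixes x y e :: "'a :: comm_ring_1"
  assumes char2: "CHAR('a) = 2" and curve: "y ^ 2 + y = x ^ 3 + x + 1"
  defines "E \<equiv> x * e + (x ^ 2 + x) * e ^ 2 + e ^ 4"
    and "g \<equiv> y * e + (y ^ 2 + y) * e ^ 2 + x * (y ^ 2 + y) * e ^ 4 + e ^ 8"
  shows "y * E + (y ^ 2 + y) * E ^ 2 + x * (y ^ 2 + y) * E ^ 4 + E ^ 8 =
    x * g + (x ^ 2 + x) * g ^ 2 + g ^ 4"
proof -
  have "of_nat 2 = (0 :: 'a)" using char2 by (metis of_nat_CHAR)
  then have "(2 :: 'a) = 0" by simp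
  then have dbl: "a + a = 0" for a :: 'a
    by (metis mult_2 mult_zero_left)
  then have dbl': "a + (a + b) = b" for a b :: 'a
    by (metis add.assoc add_0)
  have sq: "(a + b) ^ 2 = a ^ 2 + b ^ 2" for a b :: 'a
    using char2_power_add[OF char2, of a b 1] by simp
  have pow4: "a ^ 4 = (a ^ 2) ^ 2" and pow8: "a ^ 8 = ((a ^ 2) ^ 2) ^ 2" for a :: 'a
    by (simp_all flip: power_mult)
  define s where "s = x ^ 2 + x"
  define t where "t = y ^ 2 + y"
  have t: "t = x ^ 3 + x + 1" using curve by (simp add: t_def)
  have y2: "y ^ 2 = y + t" by (simp add: t_def add_ac dbl')
  define e2 where "e2 = e ^ 2"
  define e4 where "e4 = e2 ^ 2"
  define e8 where "e8 = e4 ^ 2"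
  define e16 where "e16 = e8 ^ 2"
  note e = e2_def[symmetric] e4_def[symmetric] e8_def[symmetric] e16_def[symmetric]
  note expand = sq pow4 pow8 power_mult_distrib e
  have E: "E = x * e + s * e2 + e4"
    and g: "g = y * e + t * e2 + x * t * e4 + e8"
    by (simp_all add: E_def g_def s_def t_def expand)
  \<comment> \<open>\<open>c2\<close>, \<open>c4\<close>, \<open>c8\<close>, \<open>c16\<close> compare the coefficients of \<open>e\<^sup>2\<close>, \<open>e\<^sup>4\<close>, \<open>e\<^sup>8\<close>, \<open>e\<^sup>1\<^sup>6\<close>.\<close>
  have c2: "y * s + t * x ^ 2 = x * t + s * y ^ 2"
    unfolding y2 s_def by (simp add: algebra_simps dbl dbl')
  have c4: "y + t * s ^ 2 + x * t * (x ^ 2) ^ 2 = x * (x * t) + s * t ^ 2 + (y ^ 2) ^ 2"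
    unfolding y2 sq unfolding y2 t s_def
    by (simp add: sq algebra_simps power2_eq_square power3_eq_cube dbl dbl')
  have c8: "t + x * t * (s ^ 2) ^ 2 + ((x ^ 2) ^ 2) ^ 2 = x + s * (x * t) ^ 2 + (t ^ 2) ^ 2"
    unfolding t s_def
    by (simp add: sq power_mult_distrib algebra_simps power2_eq_square power3_eq_cube dbl dbl')
  have c16: "x * t + ((s ^ 2) ^ 2) ^ 2 = s + ((x * t) ^ 2) ^ 2"
    unfolding t s_def
    by (simp add: sq power_mult_distrib algebra_simps power2_eq_square power3_eq_cube dbl dbl')
  have "y * E + t * E ^ 2 + x * t * E ^ 4 + E ^ 8 =
      x * y * e + (y * s + t * x ^ 2) * e2 + (y + t * s ^ 2 + x * t * (x ^ 2) ^ 2) * e4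
      + (t + x * t * (s ^ 2) ^ 2 + ((x ^ 2) ^ 2) ^ 2) * e8
      + (x * t + ((s ^ 2) ^ 2) ^ 2) * e16 + e16 ^ 2"
    unfolding E expand by (simp only: distrib_left distrib_right ac_simps)
  also have "\<dots> = x * y * e + (x * t + s * y ^ 2) * e2
      + (x * (x * t) + s * t ^ 2 + (y ^ 2) ^ 2) * e4 + (x + s * (x * t) ^ 2 + (t ^ 2) ^ 2) * e8
      + (s + ((x * t) ^ 2) ^ 2) * e16 + e16 ^ 2"
    by (simp only: c2 c4 c8 c16)
  also have "\<dots> = x * g + s * g ^ 2 + g ^ 4"
    unfolding g expand by (simp only: distrib_left distrib_right ac_simps)
  finally show ?thesis by (simp only: s_def t_def)
qed

lemma exp_rho_compose_mult:
  fixes c :: K and f :: "K fps"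
  assumes "fps_nth f 0 = 0"
  shows "fps_compose exp_rho (fps_const c * f) =
    fps_compose (fps_compose exp_rho (fps_const c * fps_X)) f"
proof -
  have "fps_const c * f = fps_compose (fps_const c * fps_X) f"
    using assms by (simp add: fps_compose_mult_distrib)
  then show ?thesis
    using assms by (simp add: fps_compose_assoc)
qed

lemma exp_rho_compose_x:
  assumes f: "fps_nth f 0 = 0"
  shows "fps_compose exp_rho (fps_const xK * f) = twisted_apply rho_x (fps_compose exp_rho f)"
proof -
  have "fps_compose exp_rho (fps_const xK * f) = fps_compose (twisted_apply rho_x exp_rho) f"
    by (simp only: exp_rho_compose_mult[OF f] exp_rho_x)
  then show ?thesis
    by (simp add: twisted_apply_rho_x fps_compose_add_distrib fps_compose_mult_distrib[OF f]
        fps_compose_power[OF f])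
qed

definition rho_y :: "K poly" where
  "rho_y = [:yK, yK ^ 2 + yK, xK * (yK ^ 2 + yK), 1:]"

lemma twisted_apply_rho_y:
  "twisted_apply rho_y f = fps_const yK * f + fps_const (yK ^ 2 + yK) * f ^ 2
     + fps_const (xK * (yK ^ 2 + yK)) * f ^ 4 + f ^ 8"
proof -
  have "degree rho_y = 3" by (simp add: rho_y_def)
  then show ?thesis
    by (simp add: twisted_apply_def rho_y_def eval_nat_numeral(2,3) numeral_3_eq_3 algebra_simps)
qed

text \<open>
  The functional equation for \<open>y\<close>. Both \<open>e(yz)\<close> and \<open>\<rho>\<^sub>y(e(z))\<close> are solutions \<open>f\<close> of
  \<open>f(xz) = \<rho>\<^sub>x(f(z))\<close>, the second one because \<open>\<rho>\<^sub>x\<close> and \<open>\<rho>\<^sub>y\<close> commute, and both begin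
  with \<open>y z\<close>.
\<close>

lemma exp_rho_y: "fps_compose exp_rho (fps_const yK * fps_X) = twisted_apply rho_y exp_rho"
proof (rule rho_x_eigen_unique)
  let ?X = "fps_const xK * fps_X" and ?Y = "fps_const yK * fps_X"
  have "fps_compose (fps_compose exp_rho ?Y) ?X = fps_compose exp_rho (fps_compose ?Y ?X)"
    by (simp add: fps_compose_assoc)
  also have "fps_compose ?Y ?X = fps_const xK * ?Y"
    by (simp add: fps_compose_mult_distrib mult_ac)
  also have "fps_compose exp_rho \<dots> = twisted_apply rho_x (fps_compose exp_rho ?Y)"
    by (rule exp_rho_compose_x) simp
  finally show "fps_compose (fps_compose exp_rho ?Y) ?X = twisted_apply rho_x (fps_compose exp_rho ?Y)" .
  let ?E = "fps_compose exp_rho ?X"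
  have "fps_compose (twisted_apply rho_y exp_rho) ?X = twisted_apply rho_y ?E"
    by (simp add: twisted_apply_rho_y fps_compose_add_distrib fps_compose_mult_distrib
        fps_compose_power)
  also have "\<dots> = twisted_apply rho_x (twisted_apply rho_y exp_rho)"
  proof -
    have char2: "CHAR(K fps) = 2" by (simp add: CHAR_K)
    have curve: "(fps_const yK) ^ 2 + fps_const yK = (fps_const xK) ^ 3 + fps_const xK + 1"
      using curve_relation_K by (simp flip: fps_const_1_eq_1)
    show ?thesis
      using rho_x_rho_y_commute[OF char2 curve, of exp_rho]
      by (simp add: exp_rho_x twisted_apply_rho_x twisted_apply_rho_y)
  qed
  finally show "fps_compose (twisted_apply rho_y exp_rho) ?X =
      twisted_apply rho_x (twisted_apply rho_y exp_rho)" .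
  show "fps_nth (fps_compose exp_rho ?Y) 0 = fps_nth (twisted_apply rho_y exp_rho) 0"
    by (simp add: twisted_apply_rho_y fps_nth_power_0 exp_rho_nth_0)
  show "fps_nth (fps_compose exp_rho ?Y) 1 = fps_nth (twisted_apply rho_y exp_rho) 1"
    using fps_power_pow2_nth[of exp_rho 1 1] fps_power_pow2_nth[of exp_rho 2 1]
      fps_power_pow2_nth[of exp_rho 3 1]
    by (simp add: twisted_apply_rho_y fps_compose_linear)
qed

lemma exp_rho_compose_y:
  assumes f: "fps_nth f 0 = 0"
  shows "fps_compose exp_rho (fps_const yK * f) = twisted_apply rho_y (fps_compose exp_rho f)"
proof -
  have "fps_compose exp_rho (fps_const yK * f) = fps_compose (twisted_apply rho_y exp_rho) f"
    by (simp only: exp_rho_compose_mult[OF f] exp_rho_y)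
  then show ?thesis
    by (simp add: twisted_apply_rho_y fps_compose_add_distrib fps_compose_mult_distrib[OF f]
        fps_compose_power[OF f])
qed

text \<open>
  All exponents occurring in the exponential are powers of two, and raising to such a power is
  additive.
\<close>

lemma exp_rho_compose_add:
  "fps_compose exp_rho (f + g) = fps_compose exp_rho f + fps_compose exp_rho g"
proof (rule fps_ext)
  fix n :: nat
  have "fps_nth exp_rho i * fps_nth ((f + g) ^ i) n =
      fps_nth exp_rho i * fps_nth (f ^ i) n + fps_nth exp_rho i * fps_nth (g ^ i) n" for i
  proof (cases "i \<in> range ((^) 2)")
    case True
    then have "(f + g) ^ i = f ^ i + g ^ i"
      using char2_power_add[of f g] by (auto simp: CHAR_K)
    then show ?thesis by (simp add: distrib_left)
  qed (simp add: exp_rho_nth_eq_0)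
  then show "fps_nth (fps_compose exp_rho (f + g)) n =
      fps_nth (fps_compose exp_rho f + fps_compose exp_rho g) n"
    by (simp add: fps_compose_nth sum.distrib)
qed

section \<open>The generating series of the polynomials \<open>p\<^sub>k\<close>\<close>

text \<open>
  The series \<open>e(w log z)\<close>; its coefficient at \<open>z\<^bsup>2^k\<^esup>\<close> is \<open>p\<^sub>k(w)\<close> by lemma \<open>poly_p_poly\<close>.
\<close>

definition exp_mult_log :: "K \<Rightarrow> K fps" where
  "exp_mult_log w = fps_compose exp_rho (fps_const w * log_rho)"

lemma exp_mult_log_1: "exp_mult_log 1 = fps_X"
  by (simp add: exp_mult_log_def exp_rho_log_rho)

lemma exp_mult_log_add: "exp_mult_log (v + w) = exp_mult_log v + exp_mult_log w"
  unfolding exp_mult_log_def exp_rho_compose_add[symmetric]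
  by (simp add: distrib_right flip: fps_const_add)

lemma exp_mult_log_x: "exp_mult_log (xK * w) = twisted_apply rho_x (exp_mult_log w)"
  unfolding exp_mult_log_def
  using exp_rho_compose_x[of "fps_const w * log_rho"]
  by (simp add: log_rho_nth_0 mult.assoc[symmetric])

lemma exp_mult_log_y: "exp_mult_log (yK * w) = twisted_apply rho_y (exp_mult_log w)"
  unfolding exp_mult_log_def
  using exp_rho_compose_y[of "fps_const w * log_rho"]
  by (simp add: log_rho_nth_0 mult.assoc[symmetric])

lemma sum_powers_of_two:
  fixes f :: "nat \<Rightarrow> 'a :: comm_monoid_add"
  assumes "\<And>i. i \<notin> range ((^) 2) \<Longrightarrow> f i = 0"
  shows "(\<Sum>i=0..2 ^ k. f i) = (\<Sum>j\<le>k. f (2 ^ j))"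
proof -
  have "(\<Sum>j\<le>k. f (2 ^ j)) = sum f ((^) 2 ` {..k})"
    by (subst sum.reindex) (auto simp: inj_on_def)
  also have "\<dots> = (\<Sum>i=0..2 ^ k. f i)"
  proof (rule sum.mono_neutral_left)
    show "\<forall>i\<in>{0..2 ^ k} - (^) 2 ` {..k}. f i = 0"
    proof
      fix i :: nat assume i: "i \<in> {0..2 ^ k} - (^) 2 ` {..k}"
      have "i \<notin> range ((^) 2)" using i by auto
      then show "f i = 0" by (rule assms)
    qed
  qed auto
  finally show ?thesis by simp
qed

text \<open>
  Expanding \<open>e(w log z) = \<Sum>\<^sub>j (w log z)\<^bsup>2^j\<^esup>/d\<^sub>j\<close>: raising a series to the power \<open>2\<^sup>j\<close> raises
  its coefficients to this power and multiplies the exponents by \<open>2\<^sup>j\<close>, so \<open>z\<^bsup>2^k\<^esup>\<close> arises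
  from the term \<open>z\<^bsup>2^(k-j)\<^esup>\<close> of the logarithm.
\<close>

lemma poly_p_poly: "poly (p_poly k) w = fps_nth (exp_mult_log w) (2 ^ k)"
proof -
  have log_pow: "fps_nth ((fps_const w * log_rho) ^ 2 ^ j) (2 ^ k) =
      w ^ 2 ^ j * fps_nth log_rho (2 ^ (k - j)) ^ 2 ^ j" if "j \<le> k" for j
    using that by (simp add: fps_power_pow2_nth le_imp_power_dvd power_diff power_mult_distrib)
  have "fps_nth (exp_mult_log w) (2 ^ k) =
      (\<Sum>j\<le>k. fps_nth exp_rho (2 ^ j) * fps_nth ((fps_const w * log_rho) ^ 2 ^ j) (2 ^ k))"
    unfolding exp_mult_log_def fps_compose_nth
    by (rule sum_powers_of_two) (simp add: exp_rho_nth_eq_0)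
  also have "\<dots> = (\<Sum>j\<le>k. fps_nth exp_rho (2 ^ j) * fps_nth log_rho (2 ^ (k - j)) ^ 2 ^ j * w ^ 2 ^ j)"
    by (rule sum.cong) (simp_all add: log_pow)
  also have "\<dots> = poly (p_poly k) w"
    by (simp add: p_poly_def poly_sum poly_monom d_seq_def l_seq_def divide_inverse
        power_inverse)
  finally show ?thesis by simp
qed

section \<open>The filtration of A by degree\<close>

text \<open>
  The basis \<open>{x\<^sup>i, y x\<^sup>i}\<close> of \<open>A\<close> has exactly one element of each degree other than \<open>1\<close>,
  so it can be indexed by the degree \<open>n\<close>. At \<open>n = 1\<close> the coefficient is \<open>0\<close> and the
  monomial is a junk value.
\<close>

definition basis_coeff :: "coord_ring \<Rightarrow> nat \<Rightarrow> bit" where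
  "basis_coeff a n =
     (if even n then coeff (fst (coords a)) (n div 2)
      else if n = 1 then 0 else coeff (snd (coords a)) ((n - 3) div 2))"

definition basis_monomial :: "nat \<Rightarrow> coord_ring" where
  "basis_monomial n = (if even n then xA ^ (n div 2) else yA * xA ^ ((n - 3) div 2))"

lemma basis_degrees_eq: "basis_degrees a = {n. basis_coeff a n \<noteq> 0}"
proof (intro set_eqI)
  fix n :: nat
  consider i where "n = 2 * i" | "n = 1" | i where "n = 2 * i + 3"
  proof (cases "even n")
    case False
    then obtain m where m: "n = 2 * m + 1" by (rule oddE)
    then show thesis
      using that(2) that(3)[of "m - 1"] by (cases m) simp_all
  next
    case True
    then show thesis using that(1) by (elim evenE)
  qed
  then show "n \<in> basis_degrees a \<longleftrightarrow> n \<in> {n. basis_coeff a n \<noteq> 0}"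
  proof cases
    case (1 i)
    have "2 * i \<noteq> 2 * j + 3" for j by presburger
    then show ?thesis by (simp add: basis_degrees_def basis_coeff_def 1)
  next
    case 2
    have "1 \<noteq> 2 * j" for j :: nat by presburger
    then show ?thesis by (simp add: basis_degrees_def basis_coeff_def 2 del: One_nat_def)
  next
    case (3 i)
    have "2 * i + 3 \<noteq> 2 * j" for j by presburger
    then show ?thesis by (simp add: basis_degrees_def basis_coeff_def 3)
  qed
qed

lemma A_lt_iff: "a \<in> A_lt k \<longleftrightarrow> (\<forall>n\<ge>k. basis_coeff a n = 0)"
proof (cases "a = 0")
  case True
  have "coords 0 = (0, 0)" by (rule coords_eqI) simp
  then show ?thesis
    using True by (simp add: A_lt_def degA_def basis_coeff_def)
next
  case False
  then have "a \<in> A_lt k \<longleftrightarrow> (\<forall>n\<in>basis_degrees a. n < k)"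
    using finite_basis_degrees[of a] basis_degrees_nonempty[of a]
    by (simp add: A_lt_def degA_def)
  then show ?thesis
    unfolding basis_degrees_eq by (metis (mono_tags, lifting) mem_Collect_eq not_less)
qed

lemma basis_coeff_add: "basis_coeff (a + b) n = basis_coeff a n + basis_coeff b n"
proof -
  obtain u v s t where uv: "coords a = (u, v)" and st: "coords b = (s, t)"
    by (metis surj_pair)
  have "A_of [:p + q:] = A_of [:p:] + A_of [:q:]" for p q
    by (simp flip: A_of_hom(3))
  then have "coords (a + b) = (u + s, v + t)"
    using coords_eqD[OF uv] coords_eqD[OF st]
    by (intro coords_eqI) (simp add: algebra_simps)
  then show ?thesis by (simp add: basis_coeff_def uv st)
qed

lemma xA_power: "xA ^ m = A_of [:monom 1 m:]"
proof (induction m)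
  case (Suc m)
  then show ?case by (simp add: xA_def monom_Suc flip: A_of_hom(5))
qed (simp flip: one_pCons)

lemma basis_coeff_monomial:
  assumes "m \<noteq> 1"
  shows "basis_coeff (basis_monomial m) n = (if n = m then 1 else 0)"
proof (cases "even m")
  case True
  then have "coords (basis_monomial m) = (monom 1 (m div 2), 0)"
    by (intro coords_eqI) (simp add: basis_monomial_def xA_power)
  then show ?thesis
    using True by (auto simp: basis_coeff_def elim!: evenE)
next
  case False
  define i where "i = (m - 3) div 2"
  have i: "m = 2 * i + 3"
    using assms False unfolding i_def by presburger
  have "coords (basis_monomial m) = (0, monom 1 i)"
    by (intro coords_eqI) (simp add: basis_monomial_def xA_power i)
  then show ?thesis
    using i by (auto simp: basis_coeff_def elim!: oddE)
qed

lemma A_lt_0: "A_lt 0 = {0}"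
  by (auto simp: A_lt_def degA_def)

lemma A_lt_2: "A_lt 2 = A_lt 1"
proof -
  have "basis_coeff a 1 = 0" for a
    by (simp add: basis_coeff_def)
  moreover have "1 \<le> n \<longleftrightarrow> n = 1 \<or> 2 \<le> n" for n :: nat
    by linarith
  ultimately have "(\<forall>n\<ge>1. basis_coeff a n = 0) \<longleftrightarrow> (\<forall>n\<ge>2. basis_coeff a n = 0)" for a
    by metis
  then show ?thesis
    unfolding set_eq_iff A_lt_iff by blast
qed

text \<open>
  An element of degree at most \<open>k\<close> has at \<open>basis_monomial k\<close> the coefficient \<open>0\<close> or \<open>1\<close>;
  adding the monomial switches between the two cases. All inductions over \<open>k\<close> rest on this
  decomposition. The gap at degree \<open>1\<close> is bridged by lemma \<open>A_lt_2\<close>.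
\<close>

lemma A_lt_Suc:
  assumes "k \<noteq> 1"
  shows "A_lt (Suc k) = A_lt k \<union> (+) (basis_monomial k) ` A_lt k"
    and "A_lt k \<inter> (+) (basis_monomial k) ` A_lt k = {}"
proof -
  let ?v = "basis_monomial k"
  have coeff: "basis_coeff (?v + a) n = (if n = k then 1 else 0) + basis_coeff a n" for a n
    by (simp add: basis_coeff_add basis_coeff_monomial[OF assms])
  have "a \<in> A_lt k \<or> ?v + a \<in> A_lt k" if "a \<in> A_lt (Suc k)" for a
  proof -
    have above: "basis_coeff a n = 0" if "n \<ge> k" "n \<noteq> k" for n
      using that \<open>a \<in> A_lt (Suc k)\<close> unfolding A_lt_iff by (metis Suc_leI le_neq_implies_less)
    show ?thesis
    proof (cases "basis_coeff a k = 0")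
      case True
      then have "a \<in> A_lt k" unfolding A_lt_iff using above by metis
      then show ?thesis ..
    next
      case False
      then have "\<forall>n\<ge>k. basis_coeff (?v + a) n = 0" using above by (simp add: coeff)
      then show ?thesis by (simp add: A_lt_iff)
    qed
  qed
  moreover have "a = ?v + (?v + a)" for a
    by (simp add: coord_ring_add_self flip: add.assoc)
  ultimately have "A_lt (Suc k) \<subseteq> A_lt k \<union> (+) ?v ` A_lt k"
    by blast
  moreover have "A_lt k \<union> (+) ?v ` A_lt k \<subseteq> A_lt (Suc k)"
    by (auto simp: A_lt_iff coeff)
  ultimately show "A_lt (Suc k) = A_lt k \<union> (+) ?v ` A_lt k" by blast
  have "?v + a \<notin> A_lt k" if "a \<in> A_lt k" for a
    using that coeff[of a k] by (auto simp: A_lt_iff simp del: bit_not_zero_iff intro!: exI[of _ k])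
  then show "A_lt k \<inter> (+) ?v ` A_lt k = {}"
    by blast
qed

lemma A_lt_1: "A_lt 1 = {0, 1}"
  using A_lt_Suc(1)[of 0] by (simp add: A_lt_0 basis_monomial_def insert_commute)

lemma card_A_lt:
  assumes "k \<ge> 2"
  shows "card (A_lt k) = 2 ^ (k - 1)"
  using assms
proof (induction k rule: dec_induct)
  case base
  show ?case using A_lt_2 A_lt_1 by simp
next
  case (step k)
  have "card ((+) (basis_monomial k) ` A_lt k) = card (A_lt k)"
    by (rule card_image) (simp add: inj_on_def)
  then have "card (A_lt (Suc k)) = 2 * card (A_lt k)"
    using step(1) by (simp add: A_lt_Suc card_Un_disjoint finite_A_lt)
  also have "\<dots> = 2 ^ (Suc k - 1)"
    using step by (cases k) auto
  finally show ?case .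
qed

section \<open>Vanishing of \<open>p\<^sub>k\<close> at elements of small degree\<close>

text \<open>
  A twisted polynomial of \<open>\<tau>\<close>-degree \<open>r\<close> multiplies the degree of a polynomial by at most
  \<open>2\<^sup>r\<close>.
\<close>

lemma twisted_apply_nth_eq_0:
  assumes f: "\<And>m. m > N \<Longrightarrow> fps_nth f m = 0" and n: "n > 2 ^ degree c * N"
  shows "fps_nth (twisted_apply c f) n = 0"
proof -
  have "fps_nth (f ^ 2 ^ i) n = 0" if "i \<le> degree c" for i
  proof (cases "2 ^ i dvd n")
    case True
    then obtain m where m: "n = 2 ^ i * m" by blast
    have "(2 :: nat) ^ i * N \<le> 2 ^ degree c * N"
      using that by (intro mult_right_mono power_increasing) auto
    then have "2 ^ i * N < 2 ^ i * m"
      using n unfolding m by linarith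
    then have "N < m" by simp
    then show ?thesis by (simp add: fps_power_pow2_nth m f)
  qed (simp add: fps_power_pow2_nth)
  then show ?thesis
    by (simp add: twisted_apply_def fps_sum_nth)
qed

text \<open>
  Starting from \<open>e(log z) = z\<close>, each factor \<open>x\<close> applies \<open>\<rho>\<^sub>x\<close>, of \<open>\<tau>\<close>-degree \<open>2\<close>, and a
  factor \<open>y\<close> applies \<open>\<rho>\<^sub>y\<close>, of \<open>\<tau>\<close>-degree \<open>3\<close>. So the degrees of \<open>x\<close> and \<open>y\<close> in \<open>A\<close>
  match the growth of the exponent.
\<close>

lemma exp_mult_log_basis_monomial:
  assumes "m \<noteq> 1" and "n > 2 ^ m"
  shows "fps_nth (exp_mult_log (to_fract (basis_monomial m))) n = 0"
proof -
  have x: "fps_nth (exp_mult_log (xK ^ i)) n = 0" if "n > 2 ^ (2 * i)" for i n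
    using that
  proof (induction i arbitrary: n)
    case 0
    then show ?case by (simp add: exp_mult_log_1)
  next
    case (Suc i)
    have "degree rho_x = 2" by (simp add: rho_x_def)
    then show ?case
      using Suc.prems
      by (auto simp: exp_mult_log_x intro!: twisted_apply_nth_eq_0[OF Suc.IH])
  qed
  have pow: "to_fract (xA ^ i) = xK ^ i" for i
    by (induction i) (simp_all add: xK_def)
  show ?thesis
  proof (cases "even m")
    case True
    then show ?thesis
      using assms x[of "m div 2" n] by (simp add: basis_monomial_def pow)
  next
    case False
    define i where "i = (m - 3) div 2"
    have m: "m = 3 + 2 * i"
      using assms(1) False unfolding i_def by presburger
    have "degree rho_y = 3" by (simp add: rho_y_def)
    then have "fps_nth (exp_mult_log (yK * xK ^ i)) n = 0"
      using assms(2)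
      by (auto simp: exp_mult_log_y m power_add intro!: twisted_apply_nth_eq_0[OF x])
    then show ?thesis
      using False by (simp add: basis_monomial_def pow yK_def flip: i_def)
  qed
qed

lemma exp_mult_log_A_lt:
  assumes "k \<ge> 1" "a \<in> A_lt k" "n > 2 ^ (k - 1)"
  shows "fps_nth (exp_mult_log (to_fract a)) n = 0"
  using assms
proof (induction k arbitrary: a rule: dec_induct)
  case base
  then show ?case
    by (auto simp: A_lt_1[simplified] exp_mult_log_def exp_rho_log_rho)
next
  case (step k)
  have IH: "fps_nth (exp_mult_log (to_fract b)) n = 0" if "b \<in> A_lt k" for b
  proof (rule step.IH[OF that])
    have "(2 :: nat) ^ (k - 1) \<le> 2 ^ (Suc k - 1)" by (intro power_increasing) auto
    then show "2 ^ (k - 1) < n" using step.prems(2) by linarith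
  qed
  show ?case
  proof (cases "k = 1")
    case True
    then show ?thesis using IH step.prems(1) A_lt_2 by (simp add: numeral_2_eq_2)
  next
    case False
    then consider "a \<in> A_lt k" | b where "b \<in> A_lt k" "a = basis_monomial k + b"
      using step.prems(1) A_lt_Suc(1) by blast
    then show ?thesis
    proof cases
      case 2
      have "fps_nth (exp_mult_log (to_fract (basis_monomial k))) n = 0"
        using False step.prems(2) by (intro exp_mult_log_basis_monomial) simp_all
      then show ?thesis using IH[OF 2(1)] 2(2) by (simp add: exp_mult_log_add)
    qed (rule IH)
  qed
qed

lemma p_poly_vanishes:
  assumes "k \<ge> 1" "a \<in> A_lt k"
  shows "poly (p_poly k) (to_fract a) = 0"
  unfolding poly_p_poly using assms by (intro exp_mult_log_A_lt) auto

section \<open>Linearized polynomials\<close>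

definition linearized :: "K poly \<Rightarrow> bool" where
  "linearized q \<longleftrightarrow> (\<forall>n. n \<notin> range ((^) 2) \<longrightarrow> coeff q n = 0)"

lemma linearized_add: "linearized p \<Longrightarrow> linearized q \<Longrightarrow> linearized (p + q)"
  and linearized_diff: "linearized p \<Longrightarrow> linearized q \<Longrightarrow> linearized (p - q)"
  and linearized_smult: "linearized p \<Longrightarrow> linearized (smult c p)"
  by (simp_all add: linearized_def)

lemma coeff_power2:
  "coeff (q ^ 2) n = (if even n then coeff q (n div 2) ^ 2 else 0)" for q :: "K poly"
  using fps_power2_nth[of "fps_of_poly q" n] by (simp flip: fps_of_poly_power)

lemma linearized_power2:
  assumes "linearized q"
  shows "linearized (q ^ 2)"
  unfolding linearized_def
proof (intro allI impI)
  fix n :: nat assume n: "n \<notin> range ((^) 2)"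
  have "n div 2 \<notin> range ((^) 2)" if "even n"
  proof
    assume "n div 2 \<in> range ((^) 2)"
    then obtain i where "n div 2 = 2 ^ i" by blast
    then have "n = 2 ^ Suc i" using that by auto
    then show False using n by blast
  qed
  then show "coeff (q ^ 2) n = 0"
    using assms by (simp add: coeff_power2 linearized_def)
qed

lemma poly_linearized_add:
  assumes "linearized q"
  shows "poly q (a + b) = poly q a + poly q b"
proof -
  have "coeff q i * (a + b) ^ i = coeff q i * a ^ i + coeff q i * b ^ i" for i
  proof (cases "i \<in> range ((^) 2)")
    case True
    then have "(a + b) ^ i = a ^ i + b ^ i"
      using char2_power_add[OF CHAR_K, of a b] by auto
    then show ?thesis by (simp add: distrib_left)
  qed (use assms in \<open>simp add: linearized_def\<close>)
  then show ?thesis by (simp add: poly_altdef sum.distrib)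
qed

lemma linearized_p_poly: "linearized (p_poly k)"
  unfolding linearized_def p_poly_def by (auto simp: coeff_sum coeff_monom intro!: sum.neutral)

lemma coeff_p_poly:
  "coeff (p_poly k) (2 ^ j) = (if j \<le> k then 1 / (d_seq j * l_seq (k - j) ^ 2 ^ j) else 0)"
  by (simp add: p_poly_def coeff_sum coeff_monom sum.delta cong: if_cong)

lemma e_poly_K_eq: "e_poly_K k = (\<Prod>a\<in>A_lt k. [:to_fract a, 1:])"
proof -
  have "map_poly to_fract (\<Prod>a\<in>S. [:a, 1:]) = (\<Prod>a\<in>S. [:to_fract a, 1:])"
    for S :: "coord_ring set"
    by (induction S rule: infinite_finite_induct) (simp_all add: map_poly_pCons del: mult_pCons_left)
  then show ?thesis by (simp add: e_poly_K_def e_poly_def)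
qed

lemma degree_e_poly_K: "k \<ge> 2 \<Longrightarrow> degree (e_poly_K k) = 2 ^ (k - 1)"
  by (simp add: e_poly_K_eq degree_prod_sum_eq card_A_lt)

lemma lead_coeff_e_poly_K: "lead_coeff (e_poly_K k) = 1"
  by (simp add: e_poly_K_eq lead_coeff_prod)

lemma e_poly_K_vanishes:
  assumes "a \<in> A_lt k"
  shows "poly (e_poly_K k) (to_fract a) = 0"
proof -
  have "\<exists>b\<in>A_lt k. poly [:to_fract b, 1:] (to_fract a) = 0"
    using assms by (intro bexI[of _ a]) (simp_all add: K_add_self)
  then show ?thesis
    unfolding e_poly_K_eq poly_prod by (rule prod_zero[OF finite_A_lt])
qed

lemma card_to_fract_A_lt: "k \<ge> 2 \<Longrightarrow> card (to_fract ` A_lt k) = 2 ^ (k - 1)"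
  by (subst card_image) (simp_all add: inj_on_def card_A_lt)

text \<open>
  The classical recursion \<open>e\<^sub>k\<^sub>+\<^sub>1(w) = e\<^sub>k(w) (e\<^sub>k(w) + e\<^sub>k(v)) = e\<^sub>k(w)\<^sup>2 + e\<^sub>k(v) e\<^sub>k(w)\<close>, where
  \<open>v\<close> is the basis monomial of degree \<open>k\<close>. Both sides are monic of degree \<open>2\<^sup>k\<close>, and since
  \<open>e\<^sub>k\<close> is additive, the right side vanishes at \<open>a\<close> and \<open>v + a\<close> for every root \<open>a\<close> of
  \<open>e\<^sub>k\<close>; so both have the same \<open>2\<^sup>k\<close> roots.
\<close>

lemma e_poly_K_Suc:
  assumes k: "k \<ge> 2" and lin: "linearized (e_poly_K k)"
  shows "e_poly_K (Suc k) =
    (e_poly_K k) ^ 2 + smult (poly (e_poly_K k) (to_fract (basis_monomial k))) (e_poly_K k)"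
    (is "?l = ?r")
proof (rule poly_eqI_degree_lead_coeff)
  let ?e = "e_poly_K k" and ?v = "basis_monomial k"
  have lt: "(2 :: nat) ^ (k - 1) < 2 ^ k" using k by simp
  have half: "(2 :: nat) ^ k div 2 = 2 ^ (k - 1)" using k by (cases k) auto
  have "coeff ?e (2 ^ (k - 1)) = 1"
    using lead_coeff_e_poly_K[of k] by (simp add: degree_e_poly_K[OF k])
  moreover have "coeff ?e (2 ^ k) = 0"
    using lt by (intro coeff_eq_0) (simp add: degree_e_poly_K[OF k])
  ultimately have "coeff ?r (2 ^ k) = 1"
    using k by (simp add: coeff_power2 half)
  moreover have "coeff ?l (2 ^ k) = 1"
    using lead_coeff_e_poly_K[of "Suc k"] k by (simp add: degree_e_poly_K)
  ultimately show "coeff ?l (2 ^ k) = coeff ?r (2 ^ k)" by simp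
  show "2 ^ k \<le> card (to_fract ` A_lt (Suc k))"
    using k by (simp add: card_to_fract_A_lt)
  show "degree ?l \<le> 2 ^ k" using k by (simp add: degree_e_poly_K)
  have "degree (?e ^ 2) \<le> 2 ^ k"
  proof -
    have "2 ^ (k - 1) * 2 = (2 :: nat) ^ k" using k by (cases k) auto
    then show ?thesis
      using degree_power_le[of ?e 2] by (simp only: degree_e_poly_K[OF k])
  qed
  then show "degree ?r \<le> 2 ^ k"
    using lt by (intro degree_add_le) (auto intro: order.trans[OF degree_smult_le] simp: degree_e_poly_K[OF k])
  fix z assume "z \<in> to_fract ` A_lt (Suc k)"
  then obtain a where a: "a \<in> A_lt (Suc k)" "z = to_fract a" by blast
  have "poly ?e z = 0 \<or> poly ?e z = poly ?e (to_fract ?v)"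
  proof (cases "a \<in> A_lt k")
    case False
    then obtain b where "b \<in> A_lt k" "a = ?v + b"
      using a(1) A_lt_Suc(1)[of k] k by auto
    then show ?thesis
      by (simp add: a(2) poly_linearized_add[OF lin] e_poly_K_vanishes)
  qed (simp add: a(2) e_poly_K_vanishes)
  then have "poly ?r z = 0"
    by (auto simp: power2_eq_square K_add_self)
  then show "poly ?l z = poly ?r z"
    using a by (simp add: e_poly_K_vanishes)
qed

lemma linearized_e_poly_K:
  assumes "k \<ge> 2"
  shows "linearized (e_poly_K k)"
  using assms
proof (induction k rule: dec_induct)
  case base
  have "e_poly_K 2 = [:0, 1, 1:]"
    by (simp add: e_poly_K_eq A_lt_2 A_lt_1[simplified])
  moreover have "coeff [:0, 1, 1 :: K:] n = 0" if n: "n \<notin> range ((^) 2)" for n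
  proof -
    have "n \<noteq> 2 ^ 0" "n \<noteq> 2 ^ 1" using n by blast+
    then show ?thesis by (auto simp: coeff_pCons split: nat.splits)
  qed
  ultimately show ?case by (simp only: linearized_def) blast
next
  case (step k)
  then show ?case
    by (simp only: e_poly_K_Suc linearized_add linearized_power2 linearized_smult)
qed

section \<open>The quotient\<close>

lemma l_seq_0: "l_seq 0 = 1"
  using log_rho_nth_1 by (simp add: l_seq_def)

text \<open>
  The coefficient of \<open>z\<^sup>2\<close> in \<open>e(log z) = z\<close> is \<open>b\<^sub>1 + a\<^sub>1 = 0\<close>, and \<open>a\<^sub>1 = 1\<close> by the
  functional equation of \<open>e\<close>.
\<close>

lemma l_seq_1: "l_seq 1 = 1"
proof -
  have "(xK ^ 2 + xK) * fps_nth exp_rho 2 = xK ^ 2 + xK"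
    using exp_rho_x exp_rho_nth_1 unfolding exp_equation_iff by (auto dest!: spec[of _ 2])
  then have e2: "fps_nth exp_rho 2 = 1"
    using xK_power_ne[of 2] by simp
  have "0 = fps_nth (fps_compose exp_rho log_rho) 2"
    by (simp add: exp_rho_log_rho)
  also have "\<dots> = fps_nth log_rho 2 + 1"
  proof -
    have "fps_nth (log_rho ^ 2) 2 = 1"
      using fps_power2_nth[of log_rho 2] log_rho_nth_1 by simp
    moreover have "{0..2} = {0, 1, 2 :: nat}" by auto
    ultimately show ?thesis
      by (simp add: fps_compose_nth e2 exp_rho_nth_0 exp_rho_nth_1 del: One_nat_def)
  qed
  finally have "fps_nth log_rho 2 = 1"
    by (metis K_add_self add_right_cancel)
  then show ?thesis by (simp add: l_seq_def)
qed

text \<open>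
  The difference \<open>q\<close> of the two sides is linearized, so its coefficients at the powers of two
  are all that has to be examined. They vanish from \<open>2\<^bsup>k-1\<^esup>\<close> on, by the choice of the two
  constants, so \<open>q\<close> has fewer than \<open>2\<^bsup>k-1\<^esup>\<close> roots unless it is zero. But \<open>q\<close> vanishes at
  all elements of degree less than \<open>k\<close>.
\<close>

lemma p_poly_factorization:
  assumes k: "k \<ge> 2"
  defines "C \<equiv> 1 / d_seq (k - 1) + to_fract (B_coeff k (k - 2)) ^ 2 / d_seq k"
  shows "p_poly k = smult (1 / d_seq k) (e_poly_K k ^ 2) + smult C (e_poly_K k)"
    (is "_ = ?r")
proof -
  let ?e = "e_poly_K k"
  define q where "q = p_poly k - ?r"
  have lin: "linearized q"
    unfolding q_def
    by (intro linearized_add linearized_diff linearized_smult linearized_power2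
        linearized_p_poly linearized_e_poly_K k)
  have e_top: "coeff ?e (2 ^ (k - 1)) = 1"
    using lead_coeff_e_poly_K[of k] by (simp add: degree_e_poly_K[OF k])
  have e_above: "coeff ?e (2 ^ j) = 0" if "j \<ge> k" for j
    using that k by (intro coeff_eq_0) (simp add: degree_e_poly_K)
  have e2: "coeff (?e ^ 2) (2 ^ j) = coeff ?e (2 ^ (j - 1)) ^ 2" if "j \<ge> 1" for j
    using that by (cases j) (simp_all add: coeff_power2)
  have e2_top: "coeff (?e ^ 2) (2 ^ k) = 1"
    using e2[of k] e_top k by simp
  have e2_second: "coeff (?e ^ 2) (2 ^ (k - 1)) = to_fract (B_coeff k (k - 2)) ^ 2"
    using e2[of "k - 1"] k by (simp add: B_coeff_def e_poly_K_def coeff_map_poly numeral_2_eq_2)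
  have q1: "coeff q (2 ^ (k - 1)) = 0"
  proof -
    have "coeff (p_poly k) (2 ^ (k - 1)) = 1 / d_seq (k - 1)"
      using k l_seq_1 by (simp add: coeff_p_poly)
    moreover have "coeff ?r (2 ^ (k - 1)) =
        to_fract (B_coeff k (k - 2)) ^ 2 / d_seq k + C"
      by (simp add: e2_second e_top del: One_nat_def)
    moreover have "to_fract (B_coeff k (k - 2)) ^ 2 / d_seq k + C = 1 / d_seq (k - 1)"
      unfolding C_def by (metis K_add_self add.left_commute add_0_right)
    ultimately show ?thesis by (simp only: q_def coeff_diff diff_self)
  qed
  have q2: "coeff q (2 ^ k) = 0"
    by (simp add: q_def coeff_p_poly l_seq_0 e2_top e_above)
  have q3: "coeff q (2 ^ j) = 0" if "j > k" for j
    using that e2[of j] e_above[of "j - 1"] by (simp add: q_def coeff_p_poly e_above)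
  have coeff_q: "coeff q (2 ^ j) = 0" if "j \<ge> k - 1" for j
  proof -
    have "j = k - 1 \<or> j = k \<or> j > k" using that by linarith
    then show ?thesis using q1 q2 q3 by auto
  qed
  have "degree q < 2 ^ (k - 1)"
  proof (rule degree_lessI)
    show "\<forall>n\<ge>2 ^ (k - 1). coeff q n = 0"
    proof (intro allI impI)
      fix n :: nat assume n: "2 ^ (k - 1) \<le> n"
      show "coeff q n = 0"
      proof (cases "n \<in> range ((^) 2)")
        case True
        then show ?thesis using n coeff_q by auto
      qed (use lin in \<open>simp add: linearized_def\<close>)
    qed
  qed simp
  moreover have "poly q z = 0" if "z \<in> to_fract ` A_lt k" for z
    using that k by (auto simp: q_def p_poly_vanishes e_poly_K_vanishes)
  ultimately have "q = 0"
    using card_to_fract_A_lt[OF k] by (intro poly_eqI_degree[of "to_fract ` A_lt k"]) auto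
  then show ?thesis by (simp add: q_def)
qed

theorem theorem5p1:
  fixes k :: nat
  assumes "k \<ge> 2"
  shows "let C = 1 / d_seq (k - 1) + to_fract (B_coeff k (k - 2)) ^ 2 / d_seq k
    in R_quot k = to_fract (smult (1 / d_seq k) (e_poly_K k) + [:C:])"
proof -
  define C where "C = 1 / d_seq (k - 1) + to_fract (B_coeff k (k - 2)) ^ 2 / d_seq k"
  have "p_poly k = (smult (1 / d_seq k) (e_poly_K k) + [:C:]) * e_poly_K k"
    unfolding C_def p_poly_factorization[OF assms] by (simp add: power2_eq_square distrib_right)
  then have "R_quot k = to_fract (smult (1 / d_seq k) (e_poly_K k) + [:C:])"
    using e_poly_K_nonzero[of k] by (simp add: R_quot_def)
  then show ?thesis by (simp add: C_def)
qed

end
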